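(* Let $n\in\mathbb{N}$ and $d\in\mathbb{N}\cup\{\infty\}$. Then: (i) $\mathfrak{p}_s(0)=s$ for every real sequence $s=(s_\alpha)_{\alpha\in\mathbb{N}_0^n,|\alpha|\le d}$; (ii) $\mathfrak{p}_{\mathfrak{p}_s(t_1)}(t_2)=\mathfrak{p}_s(t_1+t_2)$ for every such $s$ and all $t_1,t_2\in\mathbb{R}$; (iii) $\mathfrak{p}_{a\cdot s+b\cdot s'}=a\cdot\mathfrak{p}_s+b\cdot\mathfrak{p}_{s'}$ for all $a,b\in\mathbb{R}$ and all such sequences $s,s'$.
   Context: For any real sequence $s=(s_\alpha)_{\alpha\in\mathbb{N}_0^n,|\alpha|\le d}$ (no restriction on $|\alpha|$ if $d=\infty$; $s$ need not be a moment sequence), $\mathfrak{p}_s(t)=(\mathfrak{p}_{s,\alpha}(t))_{|\alpha|\le d}$, $t\in\mathbb{R}$, is the family of polynomials in $t$ uniquely determined recursively by $$\mathfrak{p}_{s,\alpha}(0)=s_\alpha,\qquad \frac{d}{dt}\mathfrak{p}_{s,\alpha}(t)=\sum_{j=1}^n\alpha_j(\alpha_j-1)\,\mathfrak{p}_{s,\alpha-2e_j}(t),$$ where $e_j$ is the $j$-th unit vector and terms with $\alpha_j\le 1$ are $0$. For $n=1$ this gives $\mathfrak{p}_{s,k}(t)=\sum_{j=0}^{\lfloor k/2\rfloor}\frac{k!}{(k-2j)!\,j!}s_{k-2j}t^j$. These polynomials describe the time evolution of the moments of solutions of $\partial_tu=\Delta u$. *)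

theory Defs
  imports
    "HOL-Analysis.Analysis"
    "HOL-Computational_Algebra.Polynomial"
    "HOL-Library.Extended_Nat"
begin

definition multi_indices :: "enat \<Rightarrow> (nat ^ 'n::finite) set" where
  "multi_indices d = {\<alpha>. enat (\<Sum>j\<in>UNIV. \<alpha> $ j) \<le> d}"

text \<open>
  Real sequences indexed by the multi-indices of total degree at most \<open>d\<close>. They are
  extensional functions, so that equality of two of them means equality at exactly these indices.
\<close>
definition real_seqs :: "enat \<Rightarrow> (nat ^ 'n::finite \<Rightarrow> real) set" where
  "real_seqs d = multi_indices d \<rightarrow>\<^sub>E UNIV"

text \<open>
  The term \<open>\<alpha> - axis j 2\<close> is \<open>\<alpha> - 2e\<^sub>j\<close> with truncated subtraction. When \<open>\<alpha> $ j \<le> 1\<close> its coefficient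
  \<open>\<alpha> $ j * (\<alpha> $ j - 1)\<close> is zero, so the convention that these terms vanish is built in.
\<close>
definition is_heat_family ::
    "enat \<Rightarrow> (nat ^ 'n::finite \<Rightarrow> real) \<Rightarrow> (nat ^ 'n \<Rightarrow> real poly) \<Rightarrow> bool" where
  "is_heat_family d s p \<longleftrightarrow>
     p \<in> multi_indices d \<rightarrow>\<^sub>E UNIV \<and>
     (\<forall>\<alpha>\<in>multi_indices d.
        poly (p \<alpha>) 0 = s \<alpha> \<and>
        pderiv (p \<alpha>) =
          (\<Sum>j\<in>UNIV. smult (of_nat (\<alpha> $ j * (\<alpha> $ j - 1))) (p (\<alpha> - axis j 2))))"

text \<open>
  The family \<open>\<pp>\<^sub>s\<close> of polynomials; \<open>heat_seq d s t\<close> is the real sequence \<open>\<pp>\<^sub>s(t)\<close>. The description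
  is proper by \<open>ex1_is_heat_family\<close> below, where \<open>heat_rec\<close> only serves as existence witness.
\<close>
definition heat_family ::
    "enat \<Rightarrow> (nat ^ 'n::finite \<Rightarrow> real) \<Rightarrow> nat ^ 'n \<Rightarrow> real poly" where
  "heat_family d s = (THE p. is_heat_family d s p)"

definition heat_seq ::
    "enat \<Rightarrow> (nat ^ 'n::finite \<Rightarrow> real) \<Rightarrow> real \<Rightarrow> nat ^ 'n \<Rightarrow> real" where
  "heat_seq d s t = (\<lambda>\<alpha>\<in>multi_indices d. poly (heat_family d s \<alpha>) t)"

lemma poly_antiderivative_exists:
  fixes q :: "real poly"
  shows "\<exists>p. poly p 0 = c \<and> pderiv p = q"
proof (intro exI conjI)
  let ?p = "pCons c (\<Sum>i\<le>degree q. monom (coeff q i / of_nat (Suc i)) i)"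
  show "poly ?p 0 = c" by simp
  show "pderiv ?p = q"
    by (rule poly_eqI)
       (auto simp: coeff_pderiv coeff_sum coeff_eq_0 simp del: of_nat_Suc)
qed

lemma poly_eq_if_pderiv_eq:
  fixes p q :: "real poly"
  assumes "pderiv p = pderiv q" "poly p 0 = poly q 0"
  shows "p = q"
proof (rule poly_eqI)
  fix n
  show "coeff p n = coeff q n"
  proof (cases n)
    case 0
    then show ?thesis using assms(2) by (simp add: poly_0_coeff_0)
  next
    case (Suc m)
    have "coeff (pderiv p) m = coeff (pderiv q) m" using assms(1) by simp
    then show ?thesis by (simp add: coeff_pderiv Suc del: of_nat_Suc)
  qed
qed

lemma sum_minus_axis_le:
  fixes \<alpha> :: "nat ^ 'n::finite"
  shows "(\<Sum>i\<in>UNIV. (\<alpha> - axis j k) $ i) \<le> (\<Sum>i\<in>UNIV. \<alpha> $ i)"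
  by (rule sum_mono) simp

lemma sum_minus_axis_less:
  fixes \<alpha> :: "nat ^ 'n::finite"
  assumes "\<alpha> $ j \<ge> 2"
  shows "(\<Sum>i\<in>UNIV. (\<alpha> - axis j 2) $ i) < (\<Sum>i\<in>UNIV. \<alpha> $ i)"
  by (rule sum_strict_mono_ex1) (use assms in \<open>auto intro!: exI[of _ j] simp: axis_def\<close>)

lemma minus_axis_in_multi_indices:
  "\<alpha> \<in> multi_indices d \<Longrightarrow> \<alpha> - axis j k \<in> multi_indices d"
  unfolding multi_indices_def using sum_minus_axis_le[of \<alpha> j k]
  by (auto intro: order_trans[of _ "enat (\<Sum>i\<in>UNIV. \<alpha> $ i)"])

function heat_rec :: "(nat ^ 'n::finite \<Rightarrow> real) \<Rightarrow> nat ^ 'n \<Rightarrow> real poly" where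
  "heat_rec s \<alpha> = (SOME p. poly p 0 = s \<alpha> \<and>
     pderiv p = (\<Sum>j\<in>{j. \<alpha> $ j \<ge> 2}.
       smult (of_nat (\<alpha> $ j * (\<alpha> $ j - 1))) (heat_rec s (\<alpha> - axis j 2))))"
  by auto
termination
  by (relation "Wellfounded.measure (\<lambda>(s, \<alpha>). \<Sum>i\<in>UNIV. \<alpha> $ i)")
     (auto intro: sum_minus_axis_less simp del: vector_minus_component)

declare heat_rec.simps [simp del]

lemma sum_ge_2_eq:
  fixes \<alpha> :: "nat ^ 'n::finite" and f :: "'n \<Rightarrow> real poly"
  shows "(\<Sum>j\<in>{j. \<alpha> $ j \<ge> 2}. smult (of_nat (\<alpha> $ j * (\<alpha> $ j - 1))) (f j)) =
    (\<Sum>j\<in>UNIV. smult (of_nat (\<alpha> $ j * (\<alpha> $ j - 1))) (f j))"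
  by (rule sum.mono_neutral_left) (auto simp: not_le less_2_cases_iff)

lemma heat_rec:
  "poly (heat_rec s \<alpha>) 0 = s \<alpha>"
  "pderiv (heat_rec s \<alpha>) =
    (\<Sum>j\<in>UNIV. smult (of_nat (\<alpha> $ j * (\<alpha> $ j - 1))) (heat_rec s (\<alpha> - axis j 2)))"
proof -
  let ?q = "\<Sum>j\<in>{j. \<alpha> $ j \<ge> 2}. smult (of_nat (\<alpha> $ j * (\<alpha> $ j - 1))) (heat_rec s (\<alpha> - axis j 2))"
  let ?P = "\<lambda>p. poly p 0 = s \<alpha> \<and> pderiv p = ?q"
  have "?P (SOME p. ?P p)" by (rule someI_ex[OF poly_antiderivative_exists])
  then have "?P (heat_rec s \<alpha>)" by (subst (1 2) heat_rec.simps)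
  then show "poly (heat_rec s \<alpha>) 0 = s \<alpha>"
    "pderiv (heat_rec s \<alpha>) =
      (\<Sum>j\<in>UNIV. smult (of_nat (\<alpha> $ j * (\<alpha> $ j - 1))) (heat_rec s (\<alpha> - axis j 2)))"
    by (simp_all only: sum_ge_2_eq)
qed

lemma is_heat_familyD:
  assumes "is_heat_family d s p" "\<alpha> \<in> multi_indices d"
  shows "poly (p \<alpha>) 0 = s \<alpha>"
    and "pderiv (p \<alpha>) =
      (\<Sum>j\<in>UNIV. smult (of_nat (\<alpha> $ j * (\<alpha> $ j - 1))) (p (\<alpha> - axis j 2)))"
  using assms unfolding is_heat_family_def by blast+

lemma is_heat_family_unique:
  assumes p: "is_heat_family d s p" and q: "is_heat_family d s q"
  shows "p = q"
proof (rule PiE_ext[of _ "multi_indices d" "\<lambda>_. UNIV"])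
  show "p \<in> multi_indices d \<rightarrow>\<^sub>E UNIV" "q \<in> multi_indices d \<rightarrow>\<^sub>E UNIV"
    using p q unfolding is_heat_family_def by auto
  show "p \<alpha> = q \<alpha>" if "\<alpha> \<in> multi_indices d" for \<alpha>
    using that
  proof (induction "\<Sum>i\<in>UNIV. \<alpha> $ i" arbitrary: \<alpha> rule: less_induct)
    case less
    have "p (\<alpha> - axis j 2) = q (\<alpha> - axis j 2)" if "\<alpha> $ j \<ge> 2" for j
      using less.hyps less.prems sum_minus_axis_less[OF that] minus_axis_in_multi_indices by blast
    then have "(\<Sum>j\<in>UNIV. smult (of_nat (\<alpha> $ j * (\<alpha> $ j - 1))) (p (\<alpha> - axis j 2))) =
        (\<Sum>j\<in>UNIV. smult (of_nat (\<alpha> $ j * (\<alpha> $ j - 1))) (q (\<alpha> - axis j 2)))"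
      unfolding sum_ge_2_eq[symmetric] by (intro sum.cong) auto
    then have "pderiv (p \<alpha>) = pderiv (q \<alpha>)"
      by (simp only: is_heat_familyD(2)[OF p less.prems] is_heat_familyD(2)[OF q less.prems])
    moreover have "poly (p \<alpha>) 0 = poly (q \<alpha>) 0"
      by (simp only: is_heat_familyD(1)[OF p less.prems] is_heat_familyD(1)[OF q less.prems])
    ultimately show ?case by (rule poly_eq_if_pderiv_eq)
  qed
qed

lemma ex1_is_heat_family: "\<exists>!p. is_heat_family d s p"
proof (rule ex_ex1I)
  have "is_heat_family d s (\<lambda>\<alpha>\<in>multi_indices d. heat_rec s \<alpha>)"
    unfolding is_heat_family_def by (auto simp: heat_rec minus_axis_in_multi_indices)
  then show "\<exists>p. is_heat_family d s p" by blast
qed (rule is_heat_family_unique)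

lemma is_heat_family_heat_family: "is_heat_family d s (heat_family d s)"
  unfolding heat_family_def by (rule theI'[OF ex1_is_heat_family])

end

theory Submission
  imports Defs
begin

text \<open>
  Both the time translate of a heat family and a linear combination of heat families satisfy the
  recursion, so they are identified with the heat families of their initial values by uniqueness.
\<close>

lemma heat_family_eqI: "is_heat_family d s p \<Longrightarrow> heat_family d s = p"
  by (rule is_heat_family_unique[OF is_heat_family_heat_family])

lemma pderiv_heat_family:
  assumes "\<alpha> \<in> multi_indices d"
  shows "pderiv (heat_family d s \<alpha>) =
    (\<Sum>j\<in>UNIV. smult (of_nat (\<alpha> $ j * (\<alpha> $ j - 1))) (heat_family d s (\<alpha> - axis j 2)))"
  by (rule is_heat_familyD(2)[OF is_heat_family_heat_family assms])

lemma heat_seq_0: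
  assumes "s \<in> real_seqs d"
  shows "heat_seq d s 0 = s"
proof (rule PiE_ext[of _ "multi_indices d" "\<lambda>_. UNIV"])
  show "heat_seq d s 0 \<in> multi_indices d \<rightarrow>\<^sub>E UNIV"
    by (simp add: heat_seq_def)
  \<comment> \<open>Outside the index set both functions take the default value of extensional
    functions, so only the initial values remain to be compared.\<close>
  show "s \<in> multi_indices d \<rightarrow>\<^sub>E UNIV"
    using assms by (simp add: real_seqs_def)
  show "heat_seq d s 0 \<alpha> = s \<alpha>" if "\<alpha> \<in> multi_indices d" for \<alpha>
    using that is_heat_familyD(1)[OF is_heat_family_heat_family that]
    by (simp add: heat_seq_def)
qed

text \<open>The coefficients of the recursion do not depend on time, and the inner derivative of
  \<open>[:t, 1:]\<close> is 1, so the shifted polynomials obey the same recursion; at 0 they take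
  the values at \<open>t\<close>.\<close>

lemma heat_family_heat_seq:
  "heat_family d (heat_seq d s t) =
    (\<lambda>\<alpha>\<in>multi_indices d. heat_family d s \<alpha> \<circ>\<^sub>p [:t, 1:])"
  by (rule heat_family_eqI)
     (auto simp: is_heat_family_def heat_seq_def poly_pcompose pderiv_pcompose pderiv_pCons
       pcompose_sum pcompose_smult minus_axis_in_multi_indices pderiv_heat_family)

lemma heat_seq_heat_seq: "heat_seq d (heat_seq d s t1) t2 = heat_seq d s (t1 + t2)"
  \<comment> \<open>Only the outer \<open>heat_seq\<close> is unfolded: the inner one must stay
    intact for the shift lemma to rewrite it.\<close>
  by (auto simp: heat_seq_def[of d "heat_seq d s t1"] heat_family_heat_seq)
     (auto simp: heat_seq_def poly_pcompose)

lemma smult_sum_right: "smult c (\<Sum>i\<in>A. f i) = (\<Sum>i\<in>A. smult c (f i))"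
  by (induction A rule: infinite_finite_induct) (simp_all add: smult_add_right)

text \<open>Evaluation at 0, differentiation and the right-hand side of the recursion are all linear
  in the family.\<close>

lemma heat_family_linear:
  "heat_family d (\<lambda>\<alpha>\<in>multi_indices d. a * s \<alpha> + b * s' \<alpha>) =
    (\<lambda>\<alpha>\<in>multi_indices d. smult a (heat_family d s \<alpha>) + smult b (heat_family d s' \<alpha>))"
  by (rule heat_family_eqI)
     \<comment> \<open>\<open>mult.commute\<close> reconciles the two orders in which
       \<open>a\<close> or \<open>b\<close> meets the coefficient of the recursion in nested
       \<open>smult\<close>.\<close>
     (auto simp: is_heat_family_def pderiv_add pderiv_smult pderiv_heat_family
       minus_axis_in_multi_indices is_heat_familyD(1)[OF is_heat_family_heat_family]
       smult_sum_right smult_add_right sum.distrib mult.commute)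

theorem corollary2p4:
  fixes d :: enat
  assumes "d \<ge> 1"
  shows "(\<forall>s \<in> (real_seqs d :: (nat ^ 'n::finite \<Rightarrow> real) set). heat_seq d s 0 = s) \<and>
    (\<forall>s \<in> (real_seqs d :: (nat ^ 'n::finite \<Rightarrow> real) set). \<forall>t1 t2.
       heat_seq d (heat_seq d s t1) t2 = heat_seq d s (t1 + t2)) \<and>
    (\<forall>a b. \<forall>s \<in> (real_seqs d :: (nat ^ 'n::finite \<Rightarrow> real) set). \<forall>s' \<in> real_seqs d.
       heat_family d (\<lambda>\<alpha>\<in>multi_indices d. a * s \<alpha> + b * s' \<alpha>) =
       (\<lambda>\<alpha>\<in>multi_indices d. smult a (heat_family d s \<alpha>) + smult b (heat_family d s' \<alpha>)))"
  by (simp add: heat_seq_0 heat_seq_heat_seq heat_family_linear)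

end
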